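(* Let $\omega=-\frac12+\frac{\sqrt3}{2}i$ and $$b_1=\begin{pmatrix}1&0\\0&\omega\end{pmatrix},\quad b_2=\begin{pmatrix}\frac{1}{\sqrt3}i&\frac{\sqrt2}{\sqrt3}\\-\frac{\sqrt2}{\sqrt3}&-\frac{1}{\sqrt3}i\end{pmatrix},\quad b_3=\begin{pmatrix}-\frac{\sqrt3}{2}i+\frac12k&0\\0&k\end{pmatrix},\quad b_4=\begin{pmatrix}k&0\\0&-k\end{pmatrix},\quad b_5=\begin{pmatrix}j&0\\0&j\end{pmatrix}$$ in $U_2(\mathbb{H})$. Then $$\langle b_1,b_2\rangle\subset\langle b_1,b_2,b_3\rangle\subset\langle b_1,b_2,b_3,b_4\rangle\subset\langle b_1,b_2,b_3,b_4,b_5\rangle$$ is a nested sequence of irreducible quaternionic reflection groups, of orders $24$, $120$, $720$ and $1440$, respectively.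
   Context: $\mathbb{H}$ denotes the quaternions with units $i,j,k$. $\mathbb{H}^d$ is a right $\mathbb{H}$-vector space; matrices act on the left. The inner product is $\langle v,w\rangle=\sum_j\overline{v_j}w_j$, and $U_d(\mathbb{H})$ is the group of $d\times d$ quaternionic matrices preserving it. A quaternionic reflection is a nonidentity $g\in U_d(\mathbb{H})$ which fixes pointwise a subspace of dimension $d-1$; a quaternionic reflection group is a group generated by the quaternionic reflections it contains. A group $G\subset U_d(\mathbb{H})$ is irreducible if the only $G$-invariant right $\mathbb{H}$-subspaces of $\mathbb{H}^d$ are $0$ and $\mathbb{H}^d$.
   Formalization: The matrix b_5 is taken to be diag(j,-j) instead of the printed diag(j,j), since with diag(j,j) the product of b_2 and its conjugate by b_5 has determinant 1 and trace -2/3, hence infinite order, so the last group would be infinite. *)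

theory Defs
  imports "HOL-Analysis.Analysis" "HOL-Algebra.Generated_Groups"
begin

subsection \<open>Quaternions\<close>

text \<open>\<open>Quat a b c d\<close> stands for \<open>a + b i + c j + d k\<close>, where
  \<open>i j = k\<close>, \<open>j k = i\<close>, \<open>k i = j\<close>.\<close>

datatype quat = Quat (qre: real) (qim1: real) (qim2: real) (qim3: real)

lemma quat_eq_iff:
  "p = q \<longleftrightarrow> qre p = qre q \<and> qim1 p = qim1 q \<and> qim2 p = qim2 q \<and> qim3 p = qim3 q"
  by (cases p; cases q) simp

instantiation quat :: ring_1
begin

definition zero_quat_def: "0 = Quat 0 0 0 0"

definition one_quat_def: "1 = Quat 1 0 0 0"

definition plus_quat_def:
  "p + q = Quat (qre p + qre q) (qim1 p + qim1 q) (qim2 p + qim2 q) (qim3 p + qim3 q)"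

definition uminus_quat_def:
  "- p = Quat (- qre p) (- qim1 p) (- qim2 p) (- qim3 p)"

definition minus_quat_def:
  "p - q = Quat (qre p - qre q) (qim1 p - qim1 q) (qim2 p - qim2 q) (qim3 p - qim3 q)"

definition times_quat_def:
  "p * q = Quat
     (qre p * qre q - qim1 p * qim1 q - qim2 p * qim2 q - qim3 p * qim3 q)
     (qre p * qim1 q + qim1 p * qre q + qim2 p * qim3 q - qim3 p * qim2 q)
     (qre p * qim2 q - qim1 p * qim3 q + qim2 p * qre q + qim3 p * qim1 q)
     (qre p * qim3 q + qim1 p * qim2 q - qim2 p * qim1 q + qim3 p * qre q)"

instance
  by standard
    (simp_all add: quat_eq_iff zero_quat_def one_quat_def plus_quat_def uminus_quat_def
      minus_quat_def times_quat_def algebra_simps)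

end

instantiation quat :: real_algebra_1
begin

definition scaleR_quat_def:
  "r *\<^sub>R p = Quat (r * qre p) (r * qim1 p) (r * qim2 p) (r * qim3 p)"

instance
  by standard
    (simp_all add: quat_eq_iff plus_quat_def times_quat_def scaleR_quat_def algebra_simps)

end

definition quat_i :: quat ("\<i>\<^sub>H") where "\<i>\<^sub>H = Quat 0 1 0 0"

definition quat_j :: quat ("\<j>\<^sub>H") where "\<j>\<^sub>H = Quat 0 0 1 0"

definition quat_k :: quat ("\<k>\<^sub>H") where "\<k>\<^sub>H = Quat 0 0 0 1"

definition qcnj :: "quat \<Rightarrow> quat" where
  "qcnj p = Quat (qre p) (- qim1 p) (- qim2 p) (- qim3 p)"

lemma quat_units:
  "\<i>\<^sub>H * \<i>\<^sub>H = - 1" "\<j>\<^sub>H * \<j>\<^sub>H = - 1" "\<k>\<^sub>H * \<k>\<^sub>H = - 1"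
  "\<i>\<^sub>H * \<j>\<^sub>H = \<k>\<^sub>H" "\<j>\<^sub>H * \<k>\<^sub>H = \<i>\<^sub>H" "\<k>\<^sub>H * \<i>\<^sub>H = \<j>\<^sub>H"
  "\<j>\<^sub>H * \<i>\<^sub>H = - \<k>\<^sub>H" "\<k>\<^sub>H * \<j>\<^sub>H = - \<i>\<^sub>H" "\<i>\<^sub>H * \<k>\<^sub>H = - \<j>\<^sub>H"
  by (simp_all add: quat_i_def quat_j_def quat_k_def times_quat_def uminus_quat_def one_quat_def)

instantiation quat :: inverse
begin

definition inverse_quat_def:
  "inverse p = (1 / ((qre p)\<^sup>2 + (qim1 p)\<^sup>2 + (qim2 p)\<^sup>2 + (qim3 p)\<^sup>2)) *\<^sub>R qcnj p"

definition divide_quat_def: "p div (q :: quat) = p * inverse q"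

instance ..

end

instance quat :: division_ring
proof
  fix p q :: quat
  show "p / q = p * inverse q"
    by (rule divide_quat_def)
  show "inverse (0 :: quat) = 0"
    by (simp add: inverse_quat_def zero_quat_def qcnj_def scaleR_quat_def)
  assume "p \<noteq> 0"
  define N where "N = (qre p)\<^sup>2 + (qim1 p)\<^sup>2 + (qim2 p)\<^sup>2 + (qim3 p)\<^sup>2"
  have "N \<noteq> 0"
  proof
    assume "N = 0"
    then have "(qre p)\<^sup>2 = 0 \<and> (qim1 p)\<^sup>2 = 0 \<and> (qim2 p)\<^sup>2 = 0 \<and> (qim3 p)\<^sup>2 = 0"
      unfolding N_def
      by (smt (verit) zero_le_power2)
    with \<open>p \<noteq> 0\<close> show False
      by (simp add: quat_eq_iff zero_quat_def)
  qed
  have l: "qcnj p * p = N *\<^sub>R 1" and r: "p * qcnj p = N *\<^sub>R 1"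
    by (simp_all add: quat_eq_iff N_def qcnj_def times_quat_def scaleR_quat_def one_quat_def
        power2_eq_square)
  have inv: "inverse p = (1 / N) *\<^sub>R qcnj p"
    by (simp add: inverse_quat_def N_def)
  show "inverse p * p = 1"
    using \<open>N \<noteq> 0\<close> by (simp add: inv l)
  show "p * inverse p = 1"
    using \<open>N \<noteq> 0\<close> by (simp add: inv r)
qed

instance quat :: real_div_algebra ..


subsection \<open>Right vector spaces of quaternionic column vectors\<close>

text \<open>The \<open>subspace\<close>, \<open>span\<close> and \<open>dim\<close> of the library are only available over commutative
  scalars, so their analogues for right scalar multiplication are defined here.\<close>

definition rscale :: "quat ^ 'd \<Rightarrow> quat \<Rightarrow> quat ^ 'd" where
  "rscale v q = (\<chi> l. v $ l * q)"

definition rsubspace :: "(quat ^ 'd) set \<Rightarrow> bool" where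
  "rsubspace S \<longleftrightarrow>
     0 \<in> S \<and> (\<forall>v\<in>S. \<forall>w\<in>S. v + w \<in> S) \<and> (\<forall>v\<in>S. \<forall>q. rscale v q \<in> S)"

definition rindependent :: "(quat ^ 'd) set \<Rightarrow> bool" where
  "rindependent B \<longleftrightarrow>
     (\<forall>F c. finite F \<and> F \<subseteq> B \<and> (\<Sum>v\<in>F. rscale v (c v)) = 0 \<longrightarrow> (\<forall>v\<in>F. c v = 0))"

definition has_rdim :: "(quat ^ 'd) set \<Rightarrow> nat \<Rightarrow> bool" where
  "has_rdim S n \<longleftrightarrow>
     (\<exists>B. finite B \<and> card B = n \<and> rindependent B \<and> rsubspace hull B = S)"


subsection \<open>Quaternionic reflection groups\<close>

definition qinner :: "quat ^ 'd \<Rightarrow> quat ^ 'd \<Rightarrow> quat" where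
  "qinner v w = (\<Sum>l\<in>UNIV. qcnj (v $ l) * w $ l)"

definition quat_unitary_group :: "(quat ^ 'd ^ 'd) monoid" where
  "quat_unitary_group =
     \<lparr>carrier = {A. \<forall>v w. qinner (A *v v) (A *v w) = qinner v w},
      mult = (**),
      one = mat 1\<rparr>"

definition quat_reflection :: "quat ^ 'd ^ 'd \<Rightarrow> bool" where
  "quat_reflection g \<longleftrightarrow>
     g \<in> carrier quat_unitary_group \<and> g \<noteq> mat 1 \<and>
     (\<exists>S. rsubspace S \<and> has_rdim S (CARD('d) - 1) \<and> (\<forall>v\<in>S. g *v v = v))"

definition quat_reflection_group :: "(quat ^ 'd ^ 'd) set \<Rightarrow> bool" where
  "quat_reflection_group G \<longleftrightarrow>
     subgroup G quat_unitary_group \<and>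
     G = generate quat_unitary_group {g \<in> G. quat_reflection g}"

definition quat_irreducible :: "(quat ^ 'd ^ 'd) set \<Rightarrow> bool" where
  "quat_irreducible G \<longleftrightarrow>
     (\<forall>S. rsubspace S \<and> (\<forall>g\<in>G. \<forall>v\<in>S. g *v v \<in> S) \<longrightarrow> S = {0} \<or> S = UNIV)"


subsection \<open>The generators\<close>

definition mat2 :: "quat \<Rightarrow> quat \<Rightarrow> quat \<Rightarrow> quat \<Rightarrow> quat ^ 2 ^ 2" where
  "mat2 a b c d = vector [vector [a, b], vector [c, d]]"

definition quat_omega :: quat ("\<omega>\<^sub>H") where
  "\<omega>\<^sub>H = of_real (- 1 / 2) + of_real (sqrt 3 / 2) * \<i>\<^sub>H"

definition b1 :: "quat ^ 2 ^ 2" where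
  "b1 = mat2 1 0
             0 \<omega>\<^sub>H"

definition b2 :: "quat ^ 2 ^ 2" where
  "b2 = mat2 (of_real (1 / sqrt 3) * \<i>\<^sub>H) (of_real (sqrt 2 / sqrt 3))
             (- of_real (sqrt 2 / sqrt 3)) (- of_real (1 / sqrt 3) * \<i>\<^sub>H)"

definition b3 :: "quat ^ 2 ^ 2" where
  "b3 = mat2 (- of_real (sqrt 3 / 2) * \<i>\<^sub>H + of_real (1 / 2) * \<k>\<^sub>H) 0
             0 \<k>\<^sub>H"

definition b4 :: "quat ^ 2 ^ 2" where
  "b4 = mat2 \<k>\<^sub>H 0
             0 (- \<k>\<^sub>H)"

text \<open>The source prints the lower right entry of \<open>b5\<close> as \<open>j\<close>. This is a sign error: the matrix
  \<open>B = mat2 j 0 0 j\<close> conjugates \<open>b2\<close> to its complex conjugate, and \<open>b2 ** (B ** b2 ** B\<inverse>)\<close> is a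
  complex matrix of determinant \<open>1\<close> and trace \<open>- 2 / 3\<close>. Its trace is not an algebraic integer,
  so it has infinite order, and the printed matrices generate an infinite group. With \<open>- j\<close>,
  conjugation by \<open>b5\<close> inverts each of \<open>b1\<close>, \<open>b2\<close>, \<open>b3\<close>, \<open>b4\<close>.\<close>

definition b5 :: "quat ^ 2 ^ 2" where
  "b5 = mat2 \<j>\<^sub>H 0
             0 (- \<j>\<^sub>H)"

end

theory Submission
  imports Defs
begin

text \<open>
  Modulo \<open>- 1\<close> the matrices \<open>b1, \<dots>, b4\<close> satisfy Moore's relations for the alternating groups: \<open>b1\<close>
  acts like a 3-cycle, \<open>b2, b3, b4\<close> like \<open>(1 2)(j j+1)\<close>. The four groups are double covers of
  \<open>A\<^sub>4\<close>, \<open>A\<^sub>5\<close>, \<open>A\<^sub>6\<close> and a degree 2 extension of \<open>A\<^sub>6\<close>. In the chain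
  \<open>{1, - 1} \<le> H1 = \<langle>b1, - 1\<rangle> \<le> \<langle>b1, b2\<rangle> \<le> \<dots>\<close> the next generator \<open>s\<close> normalises the group \<open>K\<close> two
  steps below and satisfies a braid relation with the generator(s) of \<open>H\<close> over \<open>K\<close>. Hence
  \<open>\<langle>H, s\<rangle> = H \<union> H s H\<close> and \<open>H \<inter> s\<inverse> H s = K\<close> as soon as \<open>s \<notin> H\<close>, so the index of \<open>H\<close> in
  \<open>\<langle>H, s\<rangle>\<close> exceeds that of \<open>K\<close> in \<open>H\<close> by one. The orders follow: \<open>6, 24, 120, 720\<close>, and
  finally, \<open>1440\<close>, with \<open>K = H\<close> for \<open>b5\<close>.

  For \<open>s \<notin> H\<close>: \<open>\<langle>b1, b2\<rangle>\<close> is complex but \<open>b3\<close> is not; \<open>b4 = x b3 y\<close> with complex \<open>x, y\<close> is impossible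
  because \<open>b4\<close> has entries in \<open>\<complex> j\<close> and \<open>b3\<close> has not; and \<open>b5\<close> lacks the rationality properties of
  the entries of \<open>\<langle>b1, b2, b3, b4\<rangle>\<close>.
\<close>

subsection \<open>Adjoining an element by one double coset\<close>

text \<open>Since \<open>s\<close> normalises \<open>K\<close>, the braid relations put
  \<open>s x s\<close> into \<open>H\<close> or \<open>H s H\<close> for every \<open>x\<close> in
  \<open>H\<close>, so the union of the two is closed under products. For the count,
  \<open>(x, y) \<mapsto> x s y\<close> maps \<open>H \<times> H\<close> onto \<open>H s H\<close>,
  and each fibre has \<open>card K\<close> elements because \<open>K\<close> is all that
  \<open>s\<close> conjugates into \<open>H\<close>. The double cosets of \<open>B\<close> have to
  cover \<open>H\<close> outside \<open>K\<close>; \<open>B = {}\<close> is the case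
  \<open>K = H\<close>.\<close>

lemma (in group) double_coset_extension:
  assumes K: "subgroup K G" and H: "subgroup H G" and finH: "finite H"
    and B: "B \<subseteq> carrier G"
    and H_eq: "H = K \<union> (\<Union>b\<in>B. {x \<otimes> b \<otimes> y | x y. x \<in> K \<and> y \<in> K})"
    and s: "s \<in> carrier G" and s_notin: "s \<notin> H" and s2: "s \<otimes> s \<in> H"
    and conj: "\<And>x. x \<in> K \<Longrightarrow> s \<otimes> x \<otimes> inv s \<in> K"
    and braid: "\<And>b. b \<in> B \<Longrightarrow> \<exists>x\<in>H. \<exists>y\<in>H. s \<otimes> b \<otimes> s = x \<otimes> s \<otimes> y"
    and A: "H = generate G A" "A \<subseteq> carrier G"
  shows "generate G (insert s A) = H \<union> {x \<otimes> s \<otimes> y | x y. x \<in> H \<and> y \<in> H}"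
    and "card (generate G (insert s A)) * card K = card H * (card H + card K)"
proof -
  define D where "D = {x \<otimes> s \<otimes> y | x y. x \<in> H \<and> y \<in> H}"
  interpret H: subgroup H G by fact
  interpret K: subgroup K G by fact
  have KH: "K \<subseteq> H" using H_eq by auto
  note [simp] = H.mem_carrier K.mem_carrier
  have DI: "x \<otimes> s \<otimes> y \<in> D" if "x \<in> H" "y \<in> H" for x y
    using that by (auto simp: D_def)
  have HD: "x \<otimes> d \<in> D" if x: "x \<in> H" and d: "d \<in> D" for x d
  proof -
    obtain p q where pq: "p \<in> H" "q \<in> H" "d = p \<otimes> s \<otimes> q" using d by (auto simp: D_def)
    then have "x \<otimes> d = (x \<otimes> p) \<otimes> s \<otimes> q" using x s by (simp add: m_assoc)
    with pq x show ?thesis by (metis DI H.m_closed)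
  qed
  have DH: "d \<otimes> x \<in> D" if x: "x \<in> H" and d: "d \<in> D" for x d
  proof -
    obtain p q where pq: "p \<in> H" "q \<in> H" "d = p \<otimes> s \<otimes> q" using d by (auto simp: D_def)
    then have "d \<otimes> x = p \<otimes> s \<otimes> (q \<otimes> x)" using x s by (simp add: m_assoc)
    with pq x show ?thesis by (metis DI H.m_closed)
  qed
  \<comment> \<open>As \<open>s \<otimes> s\<close> lies in \<open>H\<close>, the inverse of
    \<open>s\<close> differs from \<open>s\<close> by a factor in \<open>H\<close>; hence
    \<open>D\<close> is closed under inverses.\<close>
  have inv_s: "inv s = inv (s \<otimes> s) \<otimes> s" "inv s = s \<otimes> inv (s \<otimes> s)"
    using s by (simp_all add: inv_mult_group m_assoc) (simp add: m_assoc [symmetric])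
  have Dcar: "D \<subseteq> carrier G" using s by (auto simp: D_def)
  have disj: "H \<inter> D = {}"
  proof -
    have False if "x \<in> H" "y \<in> H" "x \<otimes> s \<otimes> y \<in> H" for x y
    proof -
      have "inv x \<otimes> (x \<otimes> s \<otimes> y) \<otimes> inv y \<in> H" using that by simp
      moreover have "inv x \<otimes> (x \<otimes> s \<otimes> y) \<otimes> inv y = s"
        using that s by (metis H.mem_carrier inv_closed inv_solve_left inv_solve_right m_assoc m_closed)
      ultimately show False using s_notin by simp
    qed
    then show ?thesis by (auto simp: D_def)
  qed
  have sbs: "s \<otimes> b \<otimes> s \<in> D" if "b \<in> B" for b
    using braid [OF that] DI by auto
  \<comment> \<open>Write \<open>x = p b q\<close>. The conjugates of \<open>p\<close> and
    \<open>q\<close> by \<open>s\<close> stay in \<open>K\<close>, and what remains between them is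
    \<open>s b s\<close> up to a factor in \<open>H\<close>. Because \<open>D\<close> misses
    \<open>H\<close>, this also says that an element of \<open>H\<close> which \<open>s\<close>
    conjugates into \<open>H\<close> lies in \<open>K\<close>.\<close>
  have stab: "s \<otimes> x \<otimes> inv s \<in> D" if x: "x \<in> H" "x \<notin> K" for x
  proof -
    obtain b p q where b: "b \<in> B" and p: "p \<in> K" "q \<in> K" and xe: "x = p \<otimes> b \<otimes> q"
      using x by (subst (asm) H_eq) auto
    have bc: "b \<in> carrier G" using b B by auto
    have "s \<otimes> x \<otimes> inv s = (s \<otimes> p \<otimes> inv s) \<otimes> ((s \<otimes> b \<otimes> s) \<otimes> (inv (s \<otimes> s) \<otimes> (s \<otimes> q \<otimes> inv s)))"
      using p s bc unfolding xe by (simp add: m_assoc inv_mult_group inv_solve_left)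
         (simp add: m_assoc [symmetric])
    moreover have "inv (s \<otimes> s) \<otimes> (s \<otimes> q \<otimes> inv s) \<in> H" using conj [OF p(2)] KH s2 by auto
    ultimately show ?thesis using HD [OF _ DH [OF _ sbs [OF b]]] conj [OF p(1)] KH by auto
  qed
  have shs: "s \<otimes> x \<otimes> s \<in> H \<union> D" if x: "x \<in> H" for x
  proof -
    have e: "s \<otimes> x \<otimes> s = (s \<otimes> x \<otimes> inv s) \<otimes> (s \<otimes> s)" using x s by (simp add: m_assoc inv_solve_left)
    show ?thesis
    proof (cases "x \<in> K")
      case True
      then show ?thesis unfolding e using conj [OF True] KH s2 by auto
    next
      case False
      then show ?thesis unfolding e using stab [OF x False] s2 DH by auto
    qed
  qed
  have "subgroup (H \<union> D) G"
  proof (rule subgroupI)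
    show "H \<union> D \<subseteq> carrier G" using Dcar H.subset by auto
    show "H \<union> D \<noteq> {}" using H.one_closed by blast
  next
    fix a assume "a \<in> H \<union> D"
    then show "inv a \<in> H \<union> D"
    proof
      assume "a \<in> D"
      then obtain p q where pq: "p \<in> H" "q \<in> H" "a = p \<otimes> s \<otimes> q" by (auto simp: D_def)
      have "inv a = inv q \<otimes> s \<otimes> (inv (s \<otimes> s) \<otimes> inv p)"
        using pq s inv_s(2) by (simp add: inv_mult_group m_assoc) (simp add: m_assoc [symmetric])
      then show ?thesis using pq s2 DI [of "inv q" "inv (s \<otimes> s) \<otimes> inv p"] by simp
    qed auto
  next
    fix a b assume a: "a \<in> H \<union> D" and b: "b \<in> H \<union> D"
    show "a \<otimes> b \<in> H \<union> D"
    proof (cases "a \<in> H \<or> b \<in> H")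
      case True
      then show ?thesis using a b HD DH by auto
    next
      case False
      then obtain p q p' q' where pq: "p \<in> H" "q \<in> H" "a = p \<otimes> s \<otimes> q"
          "p' \<in> H" "q' \<in> H" "b = p' \<otimes> s \<otimes> q'" using a b by (auto simp: D_def)
      have e: "a \<otimes> b = p \<otimes> (s \<otimes> (q \<otimes> p') \<otimes> s) \<otimes> q'" using pq s by (simp add: m_assoc)
      show ?thesis using shs [of "q \<otimes> p'"] pq HD DH unfolding e by auto
    qed
  qed
  moreover have "insert s A \<subseteq> H \<union> D"
  proof -
    have "A \<subseteq> H" unfolding A(1) by (auto intro: generate.incl)
    moreover have "s \<in> D" using DI [OF H.one_closed H.one_closed] s by simp
    ultimately show ?thesis by blast
  qed
  ultimately have le: "generate G (insert s A) \<subseteq> H \<union> D"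
    by (rule generate_subgroup_incl [rotated])
  have Hle: "H \<subseteq> generate G (insert s A)"
    unfolding A(1) by (rule mono_generate) auto
  have "s \<in> generate G (insert s A)" by (simp add: generate.incl)
  then have "D \<subseteq> generate G (insert s A)"
    using Hle by (fastforce simp: D_def intro: generate.eng)
  with le Hle have eq: "generate G (insert s A) = H \<union> D" by auto
  then show "generate G (insert s A) = H \<union> {x \<otimes> s \<otimes> y | x y. x \<in> H \<and> y \<in> H}"
    by (simp add: D_def)
  define f where "f = (\<lambda>(x, y). x \<otimes> s \<otimes> y)"
  have finK: "finite K" using finH KH finite_subset by blast
  have D_im: "D = f ` (H \<times> H)" by (auto simp: D_def f_def)
  have fib: "card {z \<in> H \<times> H. f z = d} = card K" if d: "d \<in> D" for d
  proof -
    obtain p q where pq: "p \<in> H" "q \<in> H" "d = p \<otimes> s \<otimes> q"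
      using d unfolding D_def by blast

    \<comment> \<open>The fibre over \<open>p s q\<close> is parametrised by \<open>K\<close>: a
      factor \<open>k\<close> put in front of \<open>q\<close> is compensated, on the other side of
      \<open>s\<close>, by its inverse conjugate.\<close>
    define g where "g k = (p \<otimes> inv (s \<otimes> k \<otimes> inv s), k \<otimes> q)" for k
    have "inj_on g K"
    proof (rule inj_onI)
      fix k k' assume "k \<in> K" "k' \<in> K" "g k = g k'"
      then show "k = k'" using pq(2) by (simp add: g_def)
    qed
    moreover have "g ` K = {z \<in> H \<times> H. f z = d}"
    proof (intro Set.set_eqI iffI)
      fix z assume "z \<in> g ` K"
      then obtain k where k: "k \<in> K" and z: "z = g k" by auto
      have "p \<otimes> inv (s \<otimes> k \<otimes> inv s) \<otimes> s \<otimes> (k \<otimes> q) = p \<otimes> s \<otimes> q"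
        using k pq s by (simp add: inv_mult_group m_assoc) (simp add: m_assoc [symmetric])
      then show "z \<in> {z \<in> H \<times> H. f z = d}"
        using conj [OF k] k pq KH by (auto simp: z g_def f_def)
    next
      fix z assume "z \<in> {z \<in> H \<times> H. f z = d}"
      then obtain x y where z: "z = (x, y)" and xy: "x \<in> H" "y \<in> H" "x \<otimes> s \<otimes> y = p \<otimes> s \<otimes> q"
        using pq by (auto simp: f_def)
      \<comment> \<open>The only possible parameter of \<open>(x, y)\<close>. From
        \<open>x s y = p s q\<close> its conjugate is \<open>inv x \<otimes> p\<close>, an element
        of \<open>H\<close>, so \<open>stab\<close> forces it into \<open>K\<close>.\<close>
      define k where "k = y \<otimes> inv q"
      have kH: "k \<in> H" using xy pq by (simp add: k_def)
      have e: "s \<otimes> k \<otimes> inv s = inv x \<otimes> p"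
      proof -
        have "x \<otimes> (s \<otimes> k) = p \<otimes> s"
        proof -
          have "x \<otimes> (s \<otimes> k) = (x \<otimes> s \<otimes> y) \<otimes> inv q"
            using xy(1,2) pq(2) s unfolding k_def by (simp add: m_assoc)
          also have "\<dots> = p \<otimes> s"
            unfolding xy(3) using pq(1,2) s by (simp add: m_assoc)
          finally show ?thesis .
        qed
        then have "s \<otimes> k = inv x \<otimes> (p \<otimes> s)"
          using xy pq s kH by (simp add: inv_solve_left)
        then show ?thesis
          using xy pq s by (simp add: m_assoc)
      qed
      then have "s \<otimes> k \<otimes> inv s \<in> H" using xy pq by simp
      then have kK: "k \<in> K" using stab [OF kH] disj by auto
      have "y = k \<otimes> q" using xy pq by (simp add: k_def m_assoc)
      moreover have "x = p \<otimes> inv (inv x \<otimes> p)"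
        using xy pq by (simp add: inv_mult_group m_assoc [symmetric])
      ultimately have "z = g k" unfolding z g_def e by simp
      then show "z \<in> g ` K" using kK by simp
    qed
    ultimately show ?thesis by (metis card_image)
  qed
  have "card H * card H = card (H \<times> H)" by (simp add: card_cartesian_product)
  also have "\<dots> = (\<Sum>d\<in>D. card {z \<in> H \<times> H. f z = d})"
    unfolding card_eq_sum D_im using finH by (intro sum.image_gen) auto
  also have "\<dots> = card D * card K" using fib by simp
  finally have "card D * card K = card H * card H" by simp
  moreover have "card (H \<union> D) = card H + card D"
    using disj finH D_im by (intro card_Un_disjoint) auto
  ultimately show "card (generate G (insert s A)) * card K = card H * (card H + card K)"
    unfolding eq by (simp add: algebra_simps)
qed

text \<open>Conjugation is a homomorphism, so its values on generators decide where it sends the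
  generated group. The hypothesis has the form \<open>s a = y s\<close> in which the matrix
  relations are verified, without inverses.\<close>

lemma (in group) conj_generate:
  assumes s: "s \<in> carrier G" and A: "A \<subseteq> carrier G" and K: "subgroup K G"
    and conj: "\<And>a. a \<in> A \<Longrightarrow> \<exists>y\<in>K. s \<otimes> a = y \<otimes> s"
    and x: "x \<in> generate G A"
  shows "s \<otimes> x \<otimes> inv s \<in> K"
  using x
proof (induction x rule: generate.induct)
  case one
  then show ?case using s K by (simp add: subgroup.one_closed)
next
  case (incl a)
  then show ?case using conj [of a] s subgroup.mem_carrier [OF K] by (auto simp: m_assoc)
next
  case (inv a)
  then obtain y where y: "y \<in> K" "s \<otimes> a = y \<otimes> s" using conj by blast
  have a: "a \<in> carrier G" using inv A by auto
  have "s \<otimes> inv a \<otimes> inv s = inv (s \<otimes> a \<otimes> inv s)" using a s by (simp add: inv_mult_group m_assoc)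
  also have "\<dots> = inv y" unfolding y(2) using s y(1) subgroup.mem_carrier [OF K] by (simp add: m_assoc)
  finally show ?case using K y(1) by (simp add: subgroup.m_inv_closed)
next
  case (eng h1 h2)
  have h: "h1 \<in> carrier G" "h2 \<in> carrier G" using eng.hyps generate_in_carrier [OF A] by auto
  have "s \<otimes> (h1 \<otimes> h2) \<otimes> inv s = (s \<otimes> h1 \<otimes> inv s) \<otimes> (s \<otimes> h2 \<otimes> inv s)"
    using h s by (simp add: m_assoc inv_solve_left)
  then show ?case using eng.IH K by (simp add: subgroup.m_closed)
qed

text \<open>Recovers the representative of a double coset; this serves to solve
  \<open>b4 = x ** b3 ** y\<close> for \<open>b3\<close>.\<close>

lemma (in group) double_coset_cancel:
  assumes "x \<in> carrier G" "s \<in> carrier G" "y \<in> carrier G"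
  shows "inv x \<otimes> (x \<otimes> s \<otimes> y) \<otimes> inv y = s"
  using assms by (simp add: m_assoc) (simp add: m_assoc [symmetric])

subsection \<open>The unitary group in dimension two\<close>

lemma qcnj_mult: "qcnj (x * y) = qcnj y * qcnj x"
  by (simp add: quat_eq_iff qcnj_def times_quat_def algebra_simps)

lemma qcnj_add: "qcnj (x + y) = qcnj x + qcnj y"
  by (simp add: quat_eq_iff qcnj_def plus_quat_def)

lemma qcnj_uminus: "qcnj (- x) = - qcnj x"
  by (simp add: quat_eq_iff qcnj_def uminus_quat_def)

lemma qcnj_qcnj [simp]: "qcnj (qcnj x) = x"
  by (simp add: quat_eq_iff qcnj_def)

lemma qcnj_0 [simp]: "qcnj 0 = 0" and qcnj_1 [simp]: "qcnj 1 = 1"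
  by (simp_all add: quat_eq_iff qcnj_def zero_quat_def one_quat_def)

lemma of_real_quat: "of_real r = Quat r 0 0 0"
  by (simp add: of_real_def scaleR_quat_def one_quat_def)

definition qnorm2 :: "quat \<Rightarrow> real" where
  "qnorm2 q = (qre q)\<^sup>2 + (qim1 q)\<^sup>2 + (qim2 q)\<^sup>2 + (qim3 q)\<^sup>2"

lemma qcnj_mult_self: "qcnj q * q = of_real (qnorm2 q)"
  and mult_qcnj_self: "q * qcnj q = of_real (qnorm2 q)"
  by (simp_all add: quat_eq_iff qcnj_def times_quat_def of_real_quat qnorm2_def power2_eq_square)

text \<open>Euler's four-square identity.\<close>

lemma qnorm2_mult: "qnorm2 (x * y) = qnorm2 x * qnorm2 y"
  by (simp add: qnorm2_def times_quat_def power2_eq_square) algebra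

lemma qnorm2_qcnj [simp]: "qnorm2 (qcnj x) = qnorm2 x"
  and qnorm2_uminus [simp]: "qnorm2 (- x) = qnorm2 x"
  by (simp_all add: qnorm2_def qcnj_def uminus_quat_def)

lemma qnorm2_eq_0_iff: "qnorm2 q = 0 \<longleftrightarrow> q = 0"
  unfolding qnorm2_def quat_eq_iff zero_quat_def
  by (auto simp: add_nonneg_eq_0_iff)

lemma mat2_nth [simp]:
  "mat2 a b c d $ 1 $ 1 = a" "mat2 a b c d $ 1 $ 2 = b"
  "mat2 a b c d $ 2 $ 1 = c" "mat2 a b c d $ 2 $ 2 = d"
  by (simp_all add: mat2_def)

lemma mat2_eta: "mat2 (A $ 1 $ 1) (A $ 1 $ 2) (A $ 2 $ 1) (A $ 2 $ 2) = A"
  by (simp add: vec_eq_iff forall_2)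

lemma mat2_cases: obtains a b c d where "A = mat2 a b c d"
  using mat2_eta by metis

lemma mat2_eq_iff: "mat2 a b c d = mat2 a' b' c' d' \<longleftrightarrow> a = a' \<and> b = b' \<and> c = c' \<and> d = d'"
  by (auto simp: vec_eq_iff forall_2)

lemma mat2_mult:
  "mat2 a b c d ** mat2 a' b' c' d' =
    mat2 (a * a' + b * c') (a * b' + b * d') (c * a' + d * c') (c * b' + d * d')"
  by (simp add: vec_eq_iff forall_2 matrix_matrix_mult_def sum_2)

lemma uminus_mat2: "- mat2 a b c d = mat2 (- a) (- b) (- c) (- d)"
  by (simp add: vec_eq_iff forall_2)

lemma mat2_1: "mat 1 = mat2 1 0 0 1"
  by (simp add: vec_eq_iff forall_2 mat_def)

lemma mat2_mult_vec: "mat2 a b c d *v vector [x, y] = vector [a * x + b * y, c * x + d * y]"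
  by (simp add: vec_eq_iff forall_2 matrix_vector_mult_def sum_2)

lemma vector_2_cases: obtains x y where "v = (vector [x, y] :: 'a :: zero ^ 2)"
  using that [of "v $ 1" "v $ 2"] by (simp add: vec_eq_iff forall_2)

lemma qinner_vector_2:
  "qinner (vector [x, y] :: quat ^ 2) (vector [x', y']) = qcnj x * x' + qcnj y * y'"
  by (simp add: qinner_def sum_2)

text \<open>Testing the form on pairs of standard basis vectors gives orthonormality of the columns.
  Conversely the form is sesquilinear, and the remaining column product is the conjugate of the
  third one.\<close>

lemma mat2_unitary_iff:
  "mat2 a b c d \<in> carrier quat_unitary_group \<longleftrightarrow>
     qcnj a * a + qcnj c * c = 1 \<and> qcnj b * b + qcnj d * d = 1 \<and> qcnj a * b + qcnj c * d = 0"
  (is "_ \<longleftrightarrow> ?cols")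
proof
  assume "mat2 a b c d \<in> carrier quat_unitary_group"
  then have "qinner (mat2 a b c d *v v) (mat2 a b c d *v w) = qinner v w" for v w
    by (simp add: quat_unitary_group_def)
  from this [of "vector [1, 0]" "vector [1, 0]"] this [of "vector [0, 1]" "vector [0, 1]"]
    this [of "vector [1, 0]" "vector [0, 1]"]
  show ?cols by (simp add: mat2_mult_vec qinner_vector_2)
next
  assume c: ?cols
  then have "qcnj (qcnj a * b + qcnj c * d) = 0" by simp
  then have c4: "qcnj b * a + qcnj d * c = 0" by (simp add: qcnj_add qcnj_mult)
  have "qinner (mat2 a b c d *v v) (mat2 a b c d *v w) = qinner v w" for v w
  proof -
    obtain x y where v: "v = vector [x, y]" by (rule vector_2_cases)
    obtain x' y' where w: "w = vector [x', y']" by (rule vector_2_cases)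
    have "qcnj (a * x + b * y) * (a * x' + b * y') + qcnj (c * x + d * y) * (c * x' + d * y') =
      qcnj x * (qcnj a * a + qcnj c * c) * x' + qcnj x * (qcnj a * b + qcnj c * d) * y' +
      qcnj y * (qcnj b * a + qcnj d * c) * x' + qcnj y * (qcnj b * b + qcnj d * d) * y'"
      by (simp add: qcnj_add qcnj_mult algebra_simps)
    then show ?thesis using c c4 by (simp add: v w mat2_mult_vec qinner_vector_2)
  qed
  then show "mat2 a b c d \<in> carrier quat_unitary_group"
    by (simp add: quat_unitary_group_def)
qed

definition mat2_adjoint :: "quat ^ 2 ^ 2 \<Rightarrow> quat ^ 2 ^ 2" where
  "mat2_adjoint A = mat2 (qcnj (A $ 1 $ 1)) (qcnj (A $ 2 $ 1)) (qcnj (A $ 1 $ 2)) (qcnj (A $ 2 $ 2))"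

lemma adjoint_mult_self:
  assumes "A \<in> carrier quat_unitary_group"
  shows "mat2_adjoint A ** A = mat 1"
proof -
  obtain a b c d where A: "A = mat2 a b c d" by (rule mat2_cases)
  from assms have c: "qcnj a * a + qcnj c * c = 1" "qcnj b * b + qcnj d * d = 1"
      "qcnj a * b + qcnj c * d = 0"
    by (auto simp: A mat2_unitary_iff)
  have "qcnj b * a + qcnj d * c = 0"
    using arg_cong [OF c(3), of qcnj] by (simp add: qcnj_add qcnj_mult)
  with c show ?thesis
    by (simp add: A mat2_adjoint_def mat2_mult mat2_1 mat2_eq_iff)
qed

text \<open>Orthonormal columns have to yield orthonormal rows over noncommutative scalars. Taking
  norms in the orthogonality relation and using the unit columns gives
  \<open>qnorm2 a = qnorm2 d\<close>, which settles the lengths of the rows.\<close>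

lemma adjoint_in_unitary_group:
  assumes "A \<in> carrier quat_unitary_group"
  shows "mat2_adjoint A \<in> carrier quat_unitary_group"
proof -
  obtain a b c d where A: "A = mat2 a b c d" by (rule mat2_cases)
  from assms have c: "qcnj a * a + qcnj c * c = 1" "qcnj b * b + qcnj d * d = 1"
      "qcnj a * b = - (qcnj c * d)"
    by (auto simp: A mat2_unitary_iff add_eq_0_iff)
  have c1: "qnorm2 a + qnorm2 c = 1" "qnorm2 b + qnorm2 d = 1"
    using c(1,2) by (simp_all add: qcnj_mult_self flip: of_real_add)
  have "qnorm2 a * qnorm2 b = qnorm2 c * qnorm2 d"
    using arg_cong [OF c(3), of qnorm2] by (simp add: qnorm2_mult)
  moreover have "qnorm2 c = 1 - qnorm2 a" "qnorm2 b = 1 - qnorm2 d" using c1 by auto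
  ultimately have ad: "qnorm2 a = qnorm2 d" by (simp add: algebra_simps)
  \<comment> \<open>Multiplication by \<open>qcnj a\<close> on the left makes column orthogonality
    applicable; the two terms are then real multiples of \<open>qcnj c\<close> and cancel. The
    factor \<open>qcnj a\<close> is removed at the end.\<close>
  have z: "a * qcnj c + b * qcnj d = 0"
  proof (cases "a = 0")
    case True
    then have "d = 0" using ad qnorm2_eq_0_iff by metis
    with True show ?thesis by simp
  next
    case False
    have "qcnj a * (a * qcnj c + b * qcnj d) = (qcnj a * a) * qcnj c + (qcnj a * b) * qcnj d"
      by (simp add: algebra_simps)
    also have "\<dots> = (qcnj a * a) * qcnj c - qcnj c * (d * qcnj d)"
      by (simp add: c(3) algebra_simps)
    also have "\<dots> = 0"
      by (simp add: qcnj_mult_self mult_qcnj_self ad of_real_def)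
    finally show ?thesis using False by (metis mult_eq_0_iff qcnj_0 qcnj_qcnj)
  qed
  have "of_real (qnorm2 a) + of_real (qnorm2 b) = (1 :: quat)"
       "of_real (qnorm2 c) + of_real (qnorm2 d) = (1 :: quat)"
    using ad c1 by (simp_all flip: of_real_add)
  then show ?thesis using z
    by (simp add: A mat2_adjoint_def mat2_unitary_iff mult_qcnj_self)
qed

lemma quat_unitary_group_simps [simp]: "x \<otimes>\<^bsub>quat_unitary_group\<^esub> y = x ** y"
  "\<one>\<^bsub>quat_unitary_group\<^esub> = mat 1"
  by (simp_all add: quat_unitary_group_def)

lemma group_quat_unitary_2: "group (quat_unitary_group :: (quat ^ 2 ^ 2) monoid)"
proof (rule groupI)
  fix A B :: "quat ^ 2 ^ 2"
  assume "A \<in> carrier quat_unitary_group" "B \<in> carrier quat_unitary_group"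
  then show "A \<otimes>\<^bsub>quat_unitary_group\<^esub> B \<in> carrier quat_unitary_group"
    by (simp add: quat_unitary_group_def flip: matrix_vector_mul_assoc)
next
  fix A :: "quat ^ 2 ^ 2"
  assume "A \<in> carrier quat_unitary_group"
  then show "\<exists>B\<in>carrier quat_unitary_group. B \<otimes>\<^bsub>quat_unitary_group\<^esub> A = \<one>\<^bsub>quat_unitary_group\<^esub>"
    by (intro bexI [of _ "mat2_adjoint A"])
      (simp_all add: adjoint_in_unitary_group adjoint_mult_self)
qed (simp_all add: matrix_mul_assoc, simp add: quat_unitary_group_def)

interpretation U2: group "quat_unitary_group :: (quat ^ 2 ^ 2) monoid"
  by (rule group_quat_unitary_2)

abbreviation (input) U2 :: "(quat ^ 2 ^ 2) monoid" where "U2 \<equiv> quat_unitary_group"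

lemma matrix_uminus_mult: "(- A) ** B = - (A ** B)" "A ** (- B) = - (A ** B)"
  for A :: "'a :: ring_1 ^ 'n ^ 'm"
  by (simp_all add: vec_eq_iff matrix_matrix_mult_def sum_negf)

lemma uminus_one_unitary: "- mat 1 \<in> carrier U2"
  by (simp add: uminus_mat2 mat2_1 mat2_unitary_iff qcnj_uminus)

subsection \<open>Coordinates for the generators\<close>

text \<open>The values \<open>a + b \<surd>3 i + c \<surd>3 j + d k\<close> of \<open>dq\<close> at rational arguments form a ring, and \<open>oq\<close>
  scales them by \<open>\<surd>6\<close>. The matrices with rational \<open>dq\<close>-entries on the diagonal and
  rational \<open>oq\<close>-entries off it are therefore closed under multiplication.\<close>

definition dq :: "real \<Rightarrow> real \<Rightarrow> real \<Rightarrow> real \<Rightarrow> quat" where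
  "dq a b c d = Quat a (sqrt 3 * b) (sqrt 3 * c) d"

definition oq :: "real \<Rightarrow> real \<Rightarrow> real \<Rightarrow> real \<Rightarrow> quat" where
  "oq a b c d = of_real (sqrt 6) * dq a b c d"

lemma of_real_commute: "of_real r * (x :: quat) = x * of_real r"
  by (simp add: of_real_def)

lemma dq_mult:
  "dq a b c d * dq a' b' c' d' =
    dq (a * a' - 3 * b * b' - 3 * c * c' - d * d') (a * b' + b * a' + c * d' - d * c')
       (a * c' - b * d' + c * a' + d * b') (a * d' + 3 * b * c' - 3 * c * b' + d * a')"
  by (simp add: dq_def times_quat_def algebra_simps)

lemma dq_add: "dq a b c d + dq a' b' c' d' = dq (a + a') (b + b') (c + c') (d + d')"
  and dq_uminus: "- dq a b c d = dq (- a) (- b) (- c) (- d)"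
  and qcnj_dq: "qcnj (dq a b c d) = dq a (- b) (- c) (- d)"
  and dq_eq_iff: "dq a b c d = dq a' b' c' d' \<longleftrightarrow> a = a' \<and> b = b' \<and> c = c' \<and> d = d'"
  and dq_0: "dq 0 0 0 0 = 0" and dq_1: "dq 1 0 0 0 = 1"
  by (simp_all add: dq_def plus_quat_def uminus_quat_def qcnj_def zero_quat_def one_quat_def
      algebra_simps)

lemma oq_add: "oq a b c d + oq a' b' c' d' = oq (a + a') (b + b') (c + c') (d + d')"
  and oq_uminus: "- oq a b c d = oq (- a) (- b) (- c) (- d)"
  and oq_eq_iff: "oq a b c d = oq a' b' c' d' \<longleftrightarrow> a = a' \<and> b = b' \<and> c = c' \<and> d = d'"
  and oq_0: "oq 0 0 0 0 = 0"
  by (simp_all add: oq_def dq_0 flip: distrib_left dq_add dq_uminus dq_eq_iff)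

lemma qcnj_oq: "qcnj (oq a b c d) = oq a (- b) (- c) (- d)"
proof -
  have "qcnj (of_real r) = of_real r" for r by (simp add: of_real_quat qcnj_def)
  then show ?thesis by (simp add: oq_def qcnj_mult qcnj_dq of_real_commute)
qed

lemma dq_mult_oq:
  "dq a b c d * oq a' b' c' d' =
    oq (a * a' - 3 * b * b' - 3 * c * c' - d * d') (a * b' + b * a' + c * d' - d * c')
       (a * c' - b * d' + c * a' + d * b') (a * d' + 3 * b * c' - 3 * c * b' + d * a')"
  unfolding oq_def dq_mult [symmetric] by (simp add: of_real_def)

lemma oq_mult_dq:
  "oq a b c d * dq a' b' c' d' =
    oq (a * a' - 3 * b * b' - 3 * c * c' - d * d') (a * b' + b * a' + c * d' - d * c')
       (a * c' - b * d' + c * a' + d * b') (a * d' + 3 * b * c' - 3 * c * b' + d * a')"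
  unfolding oq_def dq_mult [symmetric] by (simp add: mult.assoc)

lemma oq_mult:
  "oq a b c d * oq a' b' c' d' =
    dq (6 * (a * a' - 3 * b * b' - 3 * c * c' - d * d')) (6 * (a * b' + b * a' + c * d' - d * c'))
       (6 * (a * c' - b * d' + c * a' + d * b')) (6 * (a * d' + 3 * b * c' - 3 * c * b' + d * a'))"
proof -
  have "oq a b c d * oq a' b' c' d' = of_real 6 * (dq a b c d * dq a' b' c' d')"
    by (simp add: oq_def of_real_def)
  then show ?thesis
    unfolding dq_mult by (simp only:)
      (simp add: dq_def of_real_quat times_quat_def algebra_simps del: of_real_numeral)
qed

abbreviation rmat where
  "rmat p0 p1 p2 p3 q0 q1 q2 q3 r0 r1 r2 r3 s0 s1 s2 s3 \<equiv>
     mat2 (dq p0 p1 p2 p3) (oq q0 q1 q2 q3) (oq r0 r1 r2 r3) (dq s0 s1 s2 s3)"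

text \<open>This brings the entries of \<open>b2\<close> to rational multiples of
  \<open>sqrt 3\<close> on the diagonal and of \<open>sqrt 6\<close> off it.\<close>

lemma sqrt_quotients: "1 / sqrt 3 = sqrt 3 / 3" "sqrt 2 / sqrt 3 = sqrt 6 / 3"
proof -
  show "1 / sqrt 3 = sqrt 3 / 3" by (simp add: field_simps)
  show "sqrt 2 / sqrt 3 = sqrt 6 / 3"
    by (simp add: field_simps flip: real_sqrt_mult) (simp add: real_sqrt_mult [of 9 2, simplified])
qed

text \<open>With rational coefficients for \<open>b1\<close> to \<open>b4\<close>, relations between
  them become rational arithmetic. Only \<open>b5\<close> needs the coefficient
  \<open>1 / sqrt 3\<close>, since \<open>dq\<close> scales the \<open>j\<close>-component by
  \<open>sqrt 3\<close>.\<close>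

lemma b_rmat:
  "b1 = rmat 1 0 0 0  0 0 0 0  0 0 0 0  (-1/2) (1/2) 0 0"
  "b2 = rmat 0 (1/3) 0 0  (1/3) 0 0 0  (-1/3) 0 0 0  0 (-1/3) 0 0"
  "b3 = rmat 0 (-1/2) 0 (1/2)  0 0 0 0  0 0 0 0  0 0 0 1"
  "b4 = rmat 0 0 0 1  0 0 0 0  0 0 0 0  0 0 0 (-1)"
  "b5 = rmat 0 0 (1 / sqrt 3) 0  0 0 0 0  0 0 0 0  0 0 (- 1 / sqrt 3) 0"
  using sqrt_quotients
  unfolding b1_def b2_def b3_def b4_def b5_def quat_omega_def mat2_eq_iff dq_def oq_def
    quat_i_def quat_j_def quat_k_def of_real_quat zero_quat_def one_quat_def
  by (simp_all add: times_quat_def plus_quat_def uminus_quat_def)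

lemma rmat_1: "mat 1 = rmat 1 0 0 0  0 0 0 0  0 0 0 0  1 0 0 0"
  by (simp add: mat2_1 oq_0 dq_1)

lemmas rmat_simps = mat2_mult mat2_eq_iff uminus_mat2 dq_mult dq_mult_oq oq_mult_dq oq_mult
  dq_add oq_add dq_uminus oq_uminus dq_eq_iff oq_eq_iff qcnj_dq qcnj_oq

lemma b_in_unitary_group:
  "b1 \<in> carrier quat_unitary_group" "b2 \<in> carrier quat_unitary_group"
  "b3 \<in> carrier quat_unitary_group" "b4 \<in> carrier quat_unitary_group"
  "b5 \<in> carrier quat_unitary_group"
  by (simp_all add: b_rmat mat2_unitary_iff rmat_simps) (simp_all add: dq_1 dq_0 oq_0)

lemma b1_cube: "b1 ** b1 ** b1 = mat 1"
  by (simp add: b_rmat rmat_simps rmat_1)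

lemma b_squared: "b2 ** b2 = - mat 1" "b3 ** b3 = - mat 1" "b4 ** b4 = - mat 1" "b5 ** b5 = - mat 1"
  by (simp_all add: b_rmat rmat_simps rmat_1)

text \<open>In order: the braid relations of \<open>b2\<close> with both nontrivial powers of
  \<open>b1\<close>; normalisation of \<open>H1\<close> by \<open>b3\<close> and its braid relation
  with \<open>b2\<close>; normalisation of \<open>\<langle>b1, b2\<rangle>\<close> by
  \<open>b4\<close> and its braid relation with \<open>b3\<close>.\<close>

lemma moore_relations:
  "b2 ** b1 ** b2 = - (b1 ** b1 ** b2 ** b1 ** b1)"
  "b2 ** (b1 ** b1) ** b2 = b1 ** b2 ** b1"
  "b3 ** b1 = b1 ** b1 ** b3"
  "b3 ** b2 ** b3 = - (b2 ** b3 ** b2)"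
  "b4 ** b1 = b1 ** b1 ** b4"
  "b4 ** b2 = - (b2 ** b4)"
  "b4 ** b3 ** b4 = - (b3 ** b4 ** b3)"
  by (simp_all add: b_rmat rmat_simps)

text \<open>Here \<open>b1 ** b1\<close> is the inverse of \<open>b1\<close>, and the negatives of
  \<open>b2\<close>, \<open>b3\<close>, \<open>b4\<close> are their inverses. So \<open>b5\<close>
  normalises the group of the other four.\<close>

lemma b5_inverts:
  "b5 ** b1 = b1 ** b1 ** b5" "b5 ** b2 = - (b2 ** b5)"
  "b5 ** b3 = - (b3 ** b5)" "b5 ** b4 = - (b4 ** b5)"
  by (simp_all add: b_rmat rmat_simps)

subsection \<open>Reflections\<close>

lemma matrix_vec_rscale: "A *v rscale v q = rscale (A *v v) q" for v :: "quat ^ 'd"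
  by (simp add: vec_eq_iff matrix_vector_mult_def rscale_def sum_distrib_right mult.assoc)

lemma rscale_simps:
  "rscale v (p + q) = rscale v p + rscale v q" "rscale v 0 = 0" "rscale v 1 = v"
  "rscale (rscale v p) q = rscale v (p * q)"
  by (simp_all add: vec_eq_iff rscale_def algebra_simps)

lemma rscale_eq_0_iff: "rscale v q = 0 \<longleftrightarrow> v = 0 \<or> q = 0"
  by (auto simp: vec_eq_iff rscale_def)

lemma rsubspace_range_rscale: "rsubspace (range (rscale v))"
  unfolding rsubspace_def
proof (intro conjI ballI allI)
  show "0 \<in> range (rscale v)" using rscale_simps(2) [of v] rangeI [of "rscale v" 0] by simp
  show "x + y \<in> range (rscale v)" if "x \<in> range (rscale v)" "y \<in> range (rscale v)" for x y
    using that by (auto simp flip: rscale_simps(1))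
  show "rscale x q \<in> range (rscale v)" if "x \<in> range (rscale v)" for x q
    using that by (auto simp: rscale_simps(4))
qed

lemma has_rdim_line:
  assumes "v \<noteq> 0"
  shows "has_rdim (range (rscale v)) 1"
proof -
  have "rindependent {v}"
    unfolding rindependent_def
  proof (intro allI impI)
    fix F c assume F: "finite F \<and> F \<subseteq> {v} \<and> (\<Sum>v\<in>F. rscale v (c v)) = 0"
    then have "F = {} \<or> F = {v}" by auto
    then show "\<forall>v\<in>F. c v = 0"
    proof
      assume "F = {v}"
      then have "rscale v (c v) = 0" using F by simp
      with \<open>F = {v}\<close> assms show ?thesis by (simp add: rscale_eq_0_iff)
    qed simp
  qed
  moreover have "rsubspace hull {v} = range (rscale v)"
  proof (rule hull_unique)
    show "{v} \<subseteq> range (rscale v)" using rangeI [of "rscale v" 1] by (simp add: rscale_simps)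
    show "rsubspace (range (rscale v))" by (rule rsubspace_range_rscale)
  next
    fix T assume "{v} \<subseteq> T" "rsubspace T"
    then have "rscale v q \<in> T" for q by (simp add: rsubspace_def)
    then show "range (rscale v) \<subseteq> T" by blast
  qed
  ultimately show ?thesis unfolding has_rdim_def by (intro exI [of _ "{v}"]) simp
qed

text \<open>In dimension two the fixed subspace need only be a line. The left action of matrices
  commutes with right scalars, so one nonzero fixed vector provides it.\<close>

lemma quat_reflectionI:
  fixes A :: "quat ^ 2 ^ 2"
  assumes "A \<in> carrier quat_unitary_group" "A \<noteq> mat 1" "v \<noteq> 0" "A *v v = v"
  shows "quat_reflection A"
  unfolding quat_reflection_def
proof (intro conjI exI [of _ "range (rscale v)"])
  show "has_rdim (range (rscale v)) (CARD(2) - 1)" using has_rdim_line [OF assms(3)] by simp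
  show "\<forall>w\<in>range (rscale v). A *v w = w" by (simp add: matrix_vec_rscale assms(4))
qed (rule assms rsubspace_range_rscale)+

lemma quat_reflection_groupI:
  fixes A :: "(quat ^ 2 ^ 2) set"
  assumes G: "G = generate U2 A" and A: "A \<subseteq> carrier U2"
    and gen: "A \<subseteq> generate U2 {g \<in> G. quat_reflection g}"
  shows "quat_reflection_group G"
proof -
  have sub: "subgroup G U2" unfolding G using A by (rule U2.generate_is_subgroup)
  have R: "{g \<in> G. quat_reflection g} \<subseteq> carrier U2" by (auto simp: quat_reflection_def)
  have "G \<subseteq> generate U2 {g \<in> G. quat_reflection g}"
    unfolding G by (rule U2.generate_subgroup_incl) (use gen G U2.generate_is_subgroup R in auto)
  moreover have "generate U2 {g \<in> G. quat_reflection g} \<subseteq> G"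
    by (rule U2.generate_subgroup_incl) (use sub in auto)
  ultimately show ?thesis using sub by (simp add: quat_reflection_group_def)
qed

lemma vector_2_eq_0_iff: "(vector [x, y] :: quat ^ 2) = 0 \<longleftrightarrow> x = 0 \<and> y = 0"
  by (simp add: vec_eq_iff forall_2)

text \<open>The matrices \<open>b2\<close> to \<open>b5\<close> square to \<open>- mat 1\<close> and
  so fix no nonzero vector. Each of them is therefore multiplied by other generators to obtain a
  word with an explicit fixed vector.\<close>

lemma quat_reflection_words:
  "quat_reflection b1" "quat_reflection (b2 ** b1)" "quat_reflection (b2 ** b3)"
  "quat_reflection (b3 ** b4)" "quat_reflection (b5 ** (b2 ** b4))"
proof -
  have car: "x ** y \<in> carrier U2" if "x \<in> carrier U2" "y \<in> carrier U2" for x y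
    using that U2.m_closed by simp
  have nonzero: "vector [dq a b c d, oq a' b' c' d'] \<noteq> (0 :: quat ^ 2)"
    if "(a, b, c, d, a', b', c', d') \<noteq> (0, 0, 0, 0, 0, 0, 0, 0)" for a b c d a' b' c' d'
    using that dq_eq_iff [of a b c d 0 0 0 0] oq_eq_iff [of a' b' c' d' 0 0 0 0]
    by (auto simp: vector_2_eq_0_iff dq_0 oq_0)
  note simps = b_rmat rmat_1 rmat_simps mat2_mult_vec
  show "quat_reflection b1"
  proof (rule quat_reflectionI)
    show "b1 *v vector [dq 1 0 0 0, oq 0 0 0 0] = vector [dq 1 0 0 0, oq 0 0 0 0]"
      by (simp add: simps)
  qed (simp_all add: b_in_unitary_group nonzero, simp add: simps)
  show "quat_reflection (b2 ** b1)"
  proof (rule quat_reflectionI)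
    show "(b2 ** b1) *v vector [dq (-3) 1 0 0, oq 2 0 0 0] = vector [dq (-3) 1 0 0, oq 2 0 0 0]"
      by (simp add: simps)
  qed (simp_all add: b_in_unitary_group nonzero car, simp add: simps)
  show "quat_reflection (b2 ** b3)"
  proof (rule quat_reflectionI)
    show "(b2 ** b3) *v vector [dq 0 (-1) 0 3, oq 1 0 0 0] = vector [dq 0 (-1) 0 3, oq 1 0 0 0]"
      by (simp add: simps)
  qed (simp_all add: b_in_unitary_group nonzero car, simp add: simps)
  show "quat_reflection (b3 ** b4)"
  proof (rule quat_reflectionI)
    show "(b3 ** b4) *v vector [dq 0 0 0 0, oq 1 0 0 0] = vector [dq 0 0 0 0, oq 1 0 0 0]"
      by (simp add: simps)
  qed (simp_all add: b_in_unitary_group nonzero car, simp add: simps)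
  show "quat_reflection (b5 ** (b2 ** b4))"
  proof (rule quat_reflectionI)
    \<comment> \<open>The coefficients of \<open>b5\<close> bring \<open>sqrt 3\<close> into the
      fixed vector; these identities are what the comparison of coordinates requires.\<close>
    have eqs: "(sqrt 3 + 1) / sqrt 3 + 2 / sqrt 3 = sqrt 3 + 1"
      "(sqrt 3 + 1) / (sqrt 3 * 3) - 1 / (sqrt 3 * 3) = 1 / 3"
      by (simp_all add: field_simps)
    show "(b5 ** (b2 ** b4)) *v vector [dq (sqrt 3 + 1) 0 0 0, oq 0 (1/3) 0 0] =
        vector [dq (sqrt 3 + 1) 0 0 0, oq 0 (1/3) 0 0]"
      by (simp add: simps eqs)
  qed (simp_all add: b_in_unitary_group nonzero car, simp add: simps)
qed

text \<open>The difference of \<open>b1 *v v\<close> and \<open>v\<close> has first coordinate 0 and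
  second coordinate \<open>(quat_omega - 1) * y\<close>, so a nonzero invariant subspace contains a
  standard basis vector. The off-diagonal entries of \<open>b2\<close> are nonzero and produce the
  other one.\<close>

lemma quat_irreducibleI:
  assumes "b1 \<in> G" "b2 \<in> G"
  shows "quat_irreducible G"
  unfolding quat_irreducible_def
proof (intro allI impI)
  fix S :: "(quat ^ 2) set"
  assume S: "rsubspace S \<and> (\<forall>g\<in>G. \<forall>v\<in>S. g *v v \<in> S)"
  then have z: "0 \<in> S" and add: "\<And>v w. v \<in> S \<Longrightarrow> w \<in> S \<Longrightarrow> v + w \<in> S"
    and sc: "\<And>v q. v \<in> S \<Longrightarrow> rscale v q \<in> S"
    and inv: "\<And>v. v \<in> S \<Longrightarrow> b1 *v v \<in> S" "\<And>v. v \<in> S \<Longrightarrow> b2 *v v \<in> S"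
    using assms by (auto simp: rsubspace_def)
  have rs: "rscale (vector [x, y] :: quat ^ 2) q = vector [x * q, y * q]" for x y q
    by (simp add: rscale_def vec_eq_iff forall_2)
  have ad: "vector [x, y] + vector [x', y'] = (vector [x + x', y + y'] :: quat ^ 2)" for x y x' y'
    by (simp add: vec_eq_iff forall_2)
  have full: "S = UNIV" if e: "vector [1, 0] \<in> S" "vector [0, 1] \<in> S"
  proof -
    have "v \<in> S" for v
    proof -
      obtain x y where v: "v = vector [x, y]" by (rule vector_2_cases)
      show ?thesis using add [OF sc [OF e(1), of x] sc [OF e(2), of y]] by (simp add: rs ad v)
    qed
    then show ?thesis by auto
  qed
  have norm: "vector [1, 0] \<in> S" if "vector [x, 0] \<in> S" "x \<noteq> 0" for x
    using sc [OF that(1), of "inverse x"] that(2) by (simp add: rs)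
  have norm': "vector [0, 1] \<in> S" if "vector [0, x] \<in> S" "x \<noteq> 0" for x
    using sc [OF that(1), of "inverse x"] that(2) by (simp add: rs)
  define t where "t = of_real (1 / sqrt 3) * quat_i"
  have s0: "of_real (sqrt 2 / sqrt 3) \<noteq> (0 :: quat)"
    unfolding of_real_eq_0_iff by simp
  have b2: "b2 *v vector [x, y] = vector [t * x + of_real (sqrt 2 / sqrt 3) * y,
      - (of_real (sqrt 2 / sqrt 3) * x) - t * y]" for x y
    by (simp add: b2_def mat2_mult_vec t_def del: of_real_divide)
  have w: "quat_omega \<noteq> 1"
    by (simp add: quat_omega_def of_real_quat quat_i_def quat_eq_iff one_quat_def
        plus_quat_def times_quat_def)
  have "S = UNIV" if v: "v \<in> S" "v \<noteq> 0" for v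
  proof -
    obtain x y where xy: "v = vector [x, y]" by (rule vector_2_cases)
    have "vector [0, 1] \<in> S \<or> vector [1, 0] \<in> S"
    proof (cases "y = 0")
      case True
      then show ?thesis using norm v xy by (auto simp: vector_2_eq_0_iff)
    next
      case False
      have "b1 *v v + rscale v (- 1) \<in> S" using v(1) by (intro add inv sc)
      then have "vector [0, (quat_omega - 1) * y] \<in> S"
        by (simp add: xy b1_def mat2_mult_vec rs ad algebra_simps)
      then show ?thesis using norm' False w by simp
    qed
    then show ?thesis
    proof
      assume e: "vector [0, 1] \<in> S"
      \<comment> \<open>The multiple by \<open>t\<close> cancels the diagonal entry
        \<open>- t\<close> of \<open>b2\<close>, leaving only the off-diagonal one.\<close>
      have "b2 *v vector [0, 1] + rscale (vector [0, 1]) t \<in> S" using e by (intro add inv sc)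
      then have "vector [of_real (sqrt 2 / sqrt 3), 0] \<in> S" by (simp add: b2 rs ad del: of_real_divide)
      then show ?thesis using norm s0 full e by blast
    next
      assume e: "vector [1, 0] \<in> S"
      have "b2 *v vector [1, 0] + rscale (vector [1, 0]) (- t) \<in> S" using e by (intro add inv sc)
      then have "vector [0, - of_real (sqrt 2 / sqrt 3)] \<in> S" by (simp add: b2 rs ad del: of_real_divide)
      then show ?thesis using norm' s0 full e by (metis neg_equal_0_iff_equal)
    qed
  qed
  then show "S = {0} \<or> S = UNIV" using z by auto
qed

subsection \<open>The chain of groups\<close>

text \<open>The cyclic group of order 6 generated by \<open>- b1\<close>, listed so that its order
  and membership can be decided by comparing coordinates.\<close>

definition H1 :: "(quat ^ 2 ^ 2) set" where
  "H1 = {mat 1, - mat 1, b1, - b1, b1 ** b1, - (b1 ** b1)}"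

lemma H1_rmat:
  "H1 = {rmat 1 0 0 0  0 0 0 0  0 0 0 0  1 0 0 0, rmat (-1) 0 0 0  0 0 0 0  0 0 0 0  (-1) 0 0 0,
         rmat 1 0 0 0  0 0 0 0  0 0 0 0  (-1/2) (1/2) 0 0, rmat (-1) 0 0 0  0 0 0 0  0 0 0 0  (1/2) (-1/2) 0 0,
         rmat 1 0 0 0  0 0 0 0  0 0 0 0  (-1/2) (-1/2) 0 0, rmat (-1) 0 0 0  0 0 0 0  0 0 0 0  (1/2) (1/2) 0 0}"
  by (simp add: H1_def b_rmat rmat_1 rmat_simps)

lemma card_H1: "card H1 = 6"
  by (simp add: H1_rmat rmat_simps)

lemma card_minus_one: "card {mat 1, - mat 1 :: quat ^ 2 ^ 2} = 2"
  by (simp add: rmat_1 rmat_simps)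

lemma subgroup_minus_one: "subgroup {mat 1, - mat 1} U2"
proof -
  have "inv\<^bsub>U2\<^esub> (- mat 1) = - mat 1"
    using uminus_one_unitary by (intro U2.inv_equality) (simp_all add: matrix_uminus_mult)
  then show ?thesis
    using U2.one_closed U2.inv_one uminus_one_unitary
    by (intro U2.subgroupI) (auto simp: matrix_uminus_mult)
qed

lemma H1_mult: "x \<in> H1 \<Longrightarrow> y \<in> H1 \<Longrightarrow> x ** y \<in> H1"
  by (auto simp: H1_def matrix_uminus_mult matrix_mul_assoc b1_cube)

lemma H1_generate: "H1 = generate U2 {b1, - mat 1}"
proof
  have c: "b1 ** b1 \<in> carrier U2" "b1 \<in> carrier U2" using U2.m_closed b_in_unitary_group by auto
  have n: "- x \<in> carrier U2" if "x \<in> carrier U2" for x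
    using U2.m_closed [OF uminus_one_unitary that] by (simp add: matrix_uminus_mult)
  have sub: "H1 \<subseteq> carrier U2"
    using c n uminus_one_unitary U2.one_closed by (auto simp: H1_def)
  have "\<exists>y\<in>H1. y ** x = mat 1" if "x \<in> H1" for x
    using that by (auto simp: H1_def matrix_uminus_mult matrix_mul_assoc b1_cube)
  then have "inv\<^bsub>U2\<^esub> x \<in> H1" if "x \<in> H1" for x
    using that sub U2.inv_equality [of _ x] by fastforce
  then have "subgroup H1 U2"
    using sub H1_mult by (intro U2.subgroupI) (auto simp: H1_def)
  then show "generate U2 {b1, - mat 1} \<subseteq> H1"
    by (intro U2.generate_subgroup_incl) (auto simp: H1_def)
  define L where "L = generate U2 {b1, - mat 1}"
  have L: "b1 \<in> L" "- mat 1 \<in> L" "mat 1 \<in> L"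
    using generate.one [of U2 "{b1, - mat 1}"] by (auto simp: L_def intro: generate.incl)
  have m: "x ** y \<in> L" if "x \<in> L" "y \<in> L" for x y
    using that generate.eng [of x U2 "{b1, - mat 1}" y] by (simp add: L_def)
  have "- x \<in> L" if "x \<in> L" for x
    using m [OF L(2) that] by (simp add: matrix_uminus_mult)
  then show "H1 \<subseteq> generate U2 {b1, - mat 1}"
    unfolding L_def [symmetric] using L m by (simp add: H1_def)
qed

text \<open>The double coset criterion for unitary matrices, with normalisation of \<open>K\<close>
  tested only on the generators \<open>C\<close>.\<close>

lemma unitary_extension:
  fixes b :: "quat ^ 2 ^ 2"
  assumes K: "K = generate U2 C" "C \<subseteq> carrier U2" and H: "H = generate U2 A" "A \<subseteq> carrier U2"
    and finH: "finite H" and B: "B \<subseteq> carrier U2"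
    and H_eq: "H = K \<union> (\<Union>b\<in>B. {x ** b ** y | x y. x \<in> K \<and> y \<in> K})"
    and s: "s \<in> carrier U2" "s \<notin> H" "s ** s \<in> H"
    and conj: "\<And>a. a \<in> C \<Longrightarrow> \<exists>y\<in>K. s ** a = y ** s"
    and braid: "\<And>b. b \<in> B \<Longrightarrow> \<exists>x\<in>H. \<exists>y\<in>H. s ** b ** s = x ** s ** y"
  shows "generate U2 (insert s A) = H \<union> {x ** s ** y | x y. x \<in> H \<and> y \<in> H}"
    and "card (generate U2 (insert s A)) * card K = card H * (card H + card K)"
proof -
  have sK: "subgroup K U2" and sH: "subgroup H U2"
    using K H U2.generate_is_subgroup by auto
  have c: "s \<otimes>\<^bsub>U2\<^esub> x \<otimes>\<^bsub>U2\<^esub> inv\<^bsub>U2\<^esub> s \<in> K" if "x \<in> K" for x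
    by (rule U2.conj_generate [OF s(1) K(2) sK]) (use conj that K(1) in simp_all)
  note c = c [unfolded quat_unitary_group_simps]
  note ext = U2.double_coset_extension [of K H B s A, unfolded quat_unitary_group_simps]
  show "generate U2 (insert s A) = H \<union> {x ** s ** y | x y. x \<in> H \<and> y \<in> H}"
    by (rule ext(1)) (fact sK sH finH B H_eq s c braid H)+
  show "card (generate U2 (insert s A)) * card K = card H * (card H + card K)"
    by (rule ext(2)) (fact sK sH finH B H_eq s c braid H)+
qed

lemma mult_in_generate: "x \<in> generate U2 A \<Longrightarrow> y \<in> generate U2 A \<Longrightarrow> x ** y \<in> generate U2 A"
  using generate.eng [of x U2 A y] by simp

section \<open>Invariants keeping each new generator out of the preceding group\<close>

definition complex_mat :: "quat ^ 2 ^ 2 \<Rightarrow> bool" where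
  "complex_mat A \<longleftrightarrow> (\<forall>i j. qim2 (A $ i $ j) = 0 \<and> qim3 (A $ i $ j) = 0)"

definition jk_mat :: "quat ^ 2 ^ 2 \<Rightarrow> bool" where
  "jk_mat A \<longleftrightarrow> (\<forall>i j. qre (A $ i $ j) = 0 \<and> qim1 (A $ i $ j) = 0)"

lemma matrix_mult_nth_2: "(A ** B) $ i $ j = A $ i $ 1 * B $ 1 $ j + A $ i $ 2 * B $ 2 $ j"
  for A B :: "'a :: semiring_1 ^ 2 ^ 2"
  by (simp add: matrix_matrix_mult_def sum_2)

text \<open>The quaternions are graded by parity as the sum of the complex numbers and the span of
  \<open>j\<close> and \<open>k\<close>; matrix products respect this grading.\<close>

lemma complex_mat_mult: "complex_mat A \<Longrightarrow> complex_mat B \<Longrightarrow> complex_mat (A ** B)"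
  and complex_mat_mult_jk_mat: "complex_mat A \<Longrightarrow> jk_mat B \<Longrightarrow> jk_mat (A ** B)"
  and jk_mat_mult_complex_mat: "jk_mat A \<Longrightarrow> complex_mat B \<Longrightarrow> jk_mat (A ** B)"
  by (simp_all add: complex_mat_def jk_mat_def matrix_mult_nth_2 plus_quat_def times_quat_def)

lemma complex_mat_b: "x \<in> H1 \<Longrightarrow> complex_mat x" "complex_mat b2" "\<not> complex_mat b3" "\<not> complex_mat b4"
  and jk_mat_b: "jk_mat b4" "\<not> jk_mat b3"
  by (auto simp: H1_rmat b_rmat complex_mat_def jk_mat_def forall_2 dq_def oq_def of_real_quat
      times_quat_def)

lemma sqrt_3_irrational: "sqrt 3 \<notin> \<rat>"
proof
  assume "sqrt 3 \<in> \<rat>"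
  then obtain m n :: nat where n: "n \<noteq> 0" and e: "\<bar>sqrt 3\<bar> = real m / real n" and cop: "coprime m n"
    by (rule Rats_abs_nat_div_natE)
  have "sqrt 3 * real n = real m" using n e by (simp add: field_simps)
  then have "(sqrt 3 * real n)\<^sup>2 = (real m)\<^sup>2" by simp
  then have "real (3 * n\<^sup>2) = real (m\<^sup>2)" by (simp add: power_mult_distrib)
  then have eq: "3 * n\<^sup>2 = m\<^sup>2" by (simp only: of_nat_eq_iff)
  have p: "prime (3 :: nat)" by simp
  have "3 dvd m\<^sup>2" using eq by (metis dvd_triv_left)
  then have m3: "3 dvd m" using p prime_dvd_power by blast
  then obtain k where "m = 3 * k" by auto
  then have "n\<^sup>2 = 3 * k\<^sup>2" using eq by (simp add: power2_eq_square)
  then have "3 dvd n\<^sup>2" by simp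
  then have "3 dvd n" using p prime_dvd_power by blast
  with m3 cop show False by (metis coprime_common_divisor_nat numeral_eq_one_iff semiring_norm(86))
qed

definition rational_mats :: "(quat ^ 2 ^ 2) set" where
  "rational_mats =
    {rmat p0 p1 p2 p3 q0 q1 q2 q3 r0 r1 r2 r3 s0 s1 s2 s3 |
      p0 p1 p2 p3 q0 q1 q2 q3 r0 r1 r2 r3 s0 s1 s2 s3.
      {p0, p1, p2, p3, q0, q1, q2, q3, r0, r1, r2, r3, s0, s1, s2, s3} \<subseteq> \<rat>}"

text \<open>The coefficients of such a matrix are unique, so one irrational coefficient, as in
  \<open>b5\<close>, excludes it.\<close>

lemma rmat_in_rational_mats:
  "rmat p0 p1 p2 p3 q0 q1 q2 q3 r0 r1 r2 r3 s0 s1 s2 s3 \<in> rational_mats \<longleftrightarrow>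
    {p0, p1, p2, p3, q0, q1, q2, q3, r0, r1, r2, r3, s0, s1, s2, s3} \<subseteq> \<rat>"
  unfolding rational_mats_def mem_Collect_eq mat2_eq_iff dq_eq_iff oq_eq_iff by blast

lemma rational_mats_mult:
  assumes "x \<in> rational_mats" "y \<in> rational_mats"
  shows "x ** y \<in> rational_mats"
proof -
  obtain p0 p1 p2 p3 q0 q1 q2 q3 r0 r1 r2 r3 s0 s1 s2 s3
    where "x = rmat p0 p1 p2 p3 q0 q1 q2 q3 r0 r1 r2 r3 s0 s1 s2 s3"
      and "{p0, p1, p2, p3, q0, q1, q2, q3, r0, r1, r2, r3, s0, s1, s2, s3} \<subseteq> \<rat>"
    using assms(1) unfolding rational_mats_def by blast
  moreover obtain p0' p1' p2' p3' q0' q1' q2' q3' r0' r1' r2' r3' s0' s1' s2' s3'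
    where "y = rmat p0' p1' p2' p3' q0' q1' q2' q3' r0' r1' r2' r3' s0' s1' s2' s3'"
      and "{p0', p1', p2', p3', q0', q1', q2', q3', r0', r1', r2', r3', s0', s1', s2', s3'} \<subseteq> \<rat>"
    using assms(2) unfolding rational_mats_def by blast
  ultimately show ?thesis
    by (simp add: mat2_mult dq_mult dq_mult_oq oq_mult_dq oq_mult dq_add oq_add rmat_in_rational_mats)
qed

lemma b_rational: "H1 \<subseteq> rational_mats" "b2 \<in> rational_mats" "b3 \<in> rational_mats" "b4 \<in> rational_mats"
  "b5 \<notin> rational_mats"
proof -
  have "1 / sqrt 3 \<notin> \<rat>"
    using sqrt_3_irrational Rats_inverse [of "1 / sqrt 3"] by auto
  then show "b5 \<notin> rational_mats"
    by (simp add: b_rmat rmat_in_rational_mats)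
qed (simp_all add: H1_rmat b_rmat rmat_in_rational_mats)

section \<open>The orders 24, 120, 720 and 1440\<close>

lemma generate_b1_b2:
  "generate U2 {b1, b2} = H1 \<union> {x ** b2 ** y | x y. x \<in> H1 \<and> y \<in> H1}" (is "?G = ?D")
  "card (generate U2 {b1, b2}) = 24"
proof -
  have K: "{mat 1, - mat 1} = generate U2 {- mat 1}"
  proof
    have "- mat 1 \<in> generate U2 {- mat 1}" "mat 1 \<in> generate U2 {- mat 1}"
      using generate.one [of U2] by (auto intro: generate.incl)
    then show "{mat 1, - mat 1} \<subseteq> generate U2 {- mat 1}" by simp
    show "generate U2 {- mat 1} \<subseteq> {mat 1, - mat 1}"
      by (intro U2.generate_subgroup_incl subgroup_minus_one) simp
  qed
  \<comment> \<open>Double cosets of the central group of order 2 are pairs, so \<open>b1\<close>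
    and \<open>b1 ** b1\<close> represent everything in \<open>H1\<close> outside it.\<close>
  have pm: "{x ** b ** y | x y. x \<in> {mat 1, - mat 1} \<and> y \<in> {mat 1, - mat 1}} = {b, - b}"
    for b :: "quat ^ 2 ^ 2"
    by (force simp: matrix_uminus_mult)
  \<comment> \<open>Since \<open>b2 ** b2 = - mat 1\<close>, the generator \<open>- mat 1\<close> of
    \<open>H1\<close> becomes redundant once \<open>b2\<close> is present.\<close>
  have e: "insert b2 {b1, - mat 1} \<subseteq> generate U2 {b1, b2}"
  proof -
    have "b2 \<in> generate U2 {b1, b2}" "b1 \<in> generate U2 {b1, b2}" by (auto intro: generate.incl)
    then show ?thesis using mult_in_generate [of b2 "{b1, b2}" b2] by (simp add: b_squared)
  qed
  have eq: "generate U2 (insert b2 {b1, - mat 1}) = generate U2 {b1, b2}"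
  proof
    show "generate U2 (insert b2 {b1, - mat 1}) \<subseteq> generate U2 {b1, b2}"
      using e b_in_unitary_group by (intro U2.generate_subgroup_incl U2.generate_is_subgroup) auto
  qed (rule U2.mono_generate, auto)
  have in_H1: "b1 \<in> H1" "b1 ** b1 \<in> H1" "- (b1 ** b1) \<in> H1" "- mat 1 \<in> H1" by (auto simp: H1_def)
  have c: "b1 ** b1 \<in> carrier U2" using U2.m_closed b_in_unitary_group by auto
  have b2: "b2 \<notin> H1" by (simp add: H1_rmat b_rmat rmat_simps)
  have r: "\<exists>x\<in>H1. \<exists>y\<in>H1. b2 ** b ** b2 = x ** b2 ** y" if "b \<in> {b1, b1 ** b1}" for b
  proof -
    have "b2 ** b1 ** b2 = - (b1 ** b1) ** b2 ** (b1 ** b1)"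
      by (simp add: moore_relations matrix_uminus_mult matrix_mul_assoc)
    then show ?thesis using that in_H1 moore_relations(2) by auto
  qed
  have H_eq: "H1 = {mat 1, - mat 1} \<union> (\<Union>b\<in>{b1, b1 ** b1}.
      {x ** b ** y | x y. x \<in> {mat 1, - mat 1} \<and> y \<in> {mat 1, - mat 1}})"
    unfolding pm by (auto simp: H1_def)
  have fin: "finite H1" by (simp add: H1_def)
  have car: "{- mat 1} \<subseteq> carrier U2" "{b1, - mat 1} \<subseteq> carrier U2" "{b1, b1 ** b1} \<subseteq> carrier U2"
    using b_in_unitary_group uminus_one_unitary c by auto
  have sq: "b2 ** b2 \<in> H1" using in_H1 by (simp add: b_squared)
  have conj: "\<exists>y\<in>{mat 1, - mat 1}. b2 ** a = y ** b2" if "a \<in> {- mat 1}" for a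
    using that by (simp add: matrix_uminus_mult)
  \<comment> \<open>The count reads \<open>6 * (6 + 2) / 2 = 24\<close>.\<close>
  note prems = K H1_generate H_eq fin car b_in_unitary_group(2) b2 sq conj r
  have "generate U2 (insert b2 {b1, - mat 1}) = ?D"
    by (rule unitary_extension(1)) (fact prems)+
  moreover have "card (generate U2 (insert b2 {b1, - mat 1})) * card {mat 1, - mat 1 :: quat ^ 2 ^ 2} =
      card H1 * (card H1 + card {mat 1, - mat 1 :: quat ^ 2 ^ 2})"
    by (rule unitary_extension(2)) (fact prems)+
  ultimately show "?G = ?D" "card ?G = 24"
    unfolding eq card_H1 card_minus_one by simp_all
qed

lemma uminus_one_in_generate: "b2 \<in> A \<Longrightarrow> - mat 1 \<in> generate U2 A"
  using mult_in_generate [of b2 A b2] by (simp add: b_squared generate.incl)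

lemma uminus_in_generate:
  assumes "b2 \<in> A" "x \<in> generate U2 A"
  shows "- x \<in> generate U2 A"
  using mult_in_generate [OF uminus_one_in_generate assms(2)] assms(1) by (simp add: matrix_uminus_mult)

text \<open>The extension step with \<open>K = H1\<close> and
  \<open>H = \<langle>b1, b2\<rangle>\<close>: the order is
  \<open>24 * (24 + 6) / 6\<close>.\<close>

lemma generate_b1_b2_b3:
  "generate U2 {b1, b2, b3} = generate U2 {b1, b2} \<union>
     {x ** b3 ** y | x y. x \<in> generate U2 {b1, b2} \<and> y \<in> generate U2 {b1, b2}}"
    (is "?G = ?H \<union> ?D")
  "card (generate U2 {b1, b2, b3}) = 120"
proof -
  have eq: "insert b3 {b1, b2} = {b1, b2, b3}" by auto
  have "complex_mat x" if "x \<in> ?H" for x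
    using that complex_mat_b complex_mat_mult unfolding generate_b1_b2(1) by blast
  then have b3: "b3 \<notin> ?H" using complex_mat_b(3) by blast
  have in_H: "b2 \<in> ?H" "- b2 \<in> ?H" "- mat 1 \<in> ?H"
    by (simp_all add: uminus_one_in_generate uminus_in_generate generate.incl)
  \<comment> \<open>An infinite set has \<open>card\<close> 0, so the order 24 already gives
    finiteness.\<close>
  have fin: "finite ?H" using generate_b1_b2(2) card.infinite by fastforce
  have conj: "\<exists>y\<in>H1. b3 ** a = y ** b3" if "a \<in> {b1, - mat 1}" for a
  proof -
    have "b1 ** b1 \<in> H1" "- mat 1 \<in> H1" by (auto simp: H1_def)
    moreover have "b3 ** - mat 1 = - mat 1 ** b3" by (simp add: matrix_uminus_mult)
    ultimately show ?thesis using that moore_relations(3) by blast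
  qed
  have braid: "\<exists>x\<in>?H. \<exists>y\<in>?H. b3 ** b ** b3 = x ** b3 ** y" if "b \<in> {b2}" for b
    using that in_H moore_relations(4) by (metis matrix_uminus_mult(1) singletonD)
  have H_eq: "?H = H1 \<union> (\<Union>b\<in>{b2}. {x ** b ** y | x y. x \<in> H1 \<and> y \<in> H1})"
    by (simp add: generate_b1_b2(1))
  have car: "{b1, - mat 1} \<subseteq> carrier U2" "{b1, b2} \<subseteq> carrier U2" "{b2} \<subseteq> carrier U2"
    using b_in_unitary_group uminus_one_unitary by auto
  have sq: "b3 ** b3 \<in> ?H" using in_H by (simp add: b_squared)
  note ext = unitary_extension [of H1 "{b1, - mat 1}" ?H "{b1, b2}" "{b2}" b3, unfolded eq]
  note prems = H1_generate refl H_eq fin car b_in_unitary_group(3) b3 sq conj braid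
  show "?G = ?H \<union> ?D" by (rule ext(1)) (fact prems)+
  have "card ?G * card H1 = card ?H * (card ?H + card H1)" by (rule ext(2)) (fact prems)+
  then show "card ?G = 120" by (simp add: generate_b1_b2(2) card_H1)
qed

text \<open>The extension step one level higher: the order is
  \<open>120 * (120 + 24) / 24\<close>.\<close>

lemma generate_b1_b2_b3_b4:
  "generate U2 {b1, b2, b3, b4} = generate U2 {b1, b2, b3} \<union>
     {x ** b4 ** y | x y. x \<in> generate U2 {b1, b2, b3} \<and> y \<in> generate U2 {b1, b2, b3}}"
    (is "?G = ?H \<union> ?D")
  "card (generate U2 {b1, b2, b3, b4}) = 720"
proof -
  let ?K = "generate U2 {b1, b2}"
  have eq: "insert b4 {b1, b2, b3} = {b1, b2, b3, b4}" by auto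
  have cK: "complex_mat x" if "x \<in> ?K" for x
    using that complex_mat_b complex_mat_mult unfolding generate_b1_b2(1) by blast
  have b4: "b4 \<notin> ?H"
  proof
    \<comment> \<open>As \<open>b4\<close> is not complex, it lies in the double coset of
      \<open>b3\<close>. Solving for \<open>b3\<close> with complex factors would give
      \<open>b3\<close> the entries of a \<open>jk_mat\<close>.\<close>
    assume "b4 \<in> ?H"
    then obtain x y where xy: "x \<in> ?K" "y \<in> ?K" "b4 = x ** b3 ** y"
      unfolding generate_b1_b2_b3(1) using cK complex_mat_b(4) by blast
    have car: "{b1, b2} \<subseteq> carrier U2" using b_in_unitary_group by simp
    have "x \<in> carrier U2" "y \<in> carrier U2" using xy U2.generate_incl [OF car] by auto
    then have "inv\<^bsub>U2\<^esub> x ** b4 ** inv\<^bsub>U2\<^esub> y = b3"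
      using U2.double_coset_cancel [of x b3 y] b_in_unitary_group by (simp add: xy(3))
    moreover have "jk_mat (inv\<^bsub>U2\<^esub> x ** b4 ** inv\<^bsub>U2\<^esub> y)"
      using xy U2.generate_m_inv_closed [OF car] cK
      by (intro jk_mat_mult_complex_mat complex_mat_mult_jk_mat jk_mat_b) auto
    ultimately show False using jk_mat_b by simp
  qed
  have in_H: "b3 \<in> ?H" "- b3 \<in> ?H" "- mat 1 \<in> ?H"
    by (simp_all add: uminus_one_in_generate uminus_in_generate generate.incl)
  have fin: "finite ?H" using generate_b1_b2_b3(2) card.infinite by fastforce
  have conj: "\<exists>y\<in>?K. b4 ** a = y ** b4" if "a \<in> {b1, b2}" for a
  proof -
    have "b1 ** b1 \<in> ?K" "- b2 \<in> ?K"
      by (simp_all add: uminus_in_generate mult_in_generate generate.incl)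
    moreover have "b4 ** b2 = - b2 ** b4" by (simp add: matrix_uminus_mult moore_relations)
    ultimately show ?thesis using that moore_relations(5) by blast
  qed
  have braid: "\<exists>x\<in>?H. \<exists>y\<in>?H. b4 ** b ** b4 = x ** b4 ** y" if "b \<in> {b3}" for b
    using that in_H moore_relations(7) by (metis matrix_uminus_mult(1) singletonD)
  have H_eq: "?H = ?K \<union> (\<Union>b\<in>{b3}. {x ** b ** y | x y. x \<in> ?K \<and> y \<in> ?K})"
    by (simp add: generate_b1_b2_b3(1))
  have car: "{b1, b2} \<subseteq> carrier U2" "{b1, b2, b3} \<subseteq> carrier U2" "{b3} \<subseteq> carrier U2"
    using b_in_unitary_group by auto
  have sq: "b4 ** b4 \<in> ?H" using in_H by (simp add: b_squared)
  note ext = unitary_extension [of ?K "{b1, b2}" ?H "{b1, b2, b3}" "{b3}" b4, unfolded eq]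
  note prems = refl H_eq fin car b_in_unitary_group(4) b4 sq conj braid
  show "?G = ?H \<union> ?D" by (rule ext(1)) (fact prems)+
  have "card ?G * card ?K = card ?H * (card ?H + card ?K)" by (rule ext(2)) (fact prems)+
  then show "card ?G = 720" by (simp add: generate_b1_b2(2) generate_b1_b2_b3(2))
qed

text \<open>Here \<open>b5\<close> normalises the whole preceding group and its square lies in it,
  so the index is 2. This is the extension step with \<open>K = H\<close> and no braid
  relation.\<close>

lemma card_generate_b1_b2_b3_b4_b5: "card (generate U2 {b1, b2, b3, b4, b5}) = 1440"
proof -
  let ?H = "generate U2 {b1, b2, b3, b4}"
  have eq: "insert b5 {b1, b2, b3, b4} = {b1, b2, b3, b4, b5}" by auto
  \<comment> \<open>The double coset descriptions involve no inverses, so closure of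
    \<open>rational_mats\<close> under products carries rationality up the chain.\<close>
  have "generate U2 {b1, b2} \<subseteq> rational_mats"
    unfolding generate_b1_b2(1) using b_rational rational_mats_mult by blast
  then have "generate U2 {b1, b2, b3} \<subseteq> rational_mats"
    unfolding generate_b1_b2_b3(1) using b_rational rational_mats_mult by blast
  then have "?H \<subseteq> rational_mats"
    unfolding generate_b1_b2_b3_b4(1) using b_rational rational_mats_mult by blast
  then have b5: "b5 \<notin> ?H" using b_rational(5) by blast
  have in_H: "- mat 1 \<in> ?H" by (simp add: uminus_one_in_generate)
  have fin: "finite ?H" using generate_b1_b2_b3_b4(2) card.infinite by fastforce
  have conj: "\<exists>y\<in>?H. b5 ** a = y ** b5" if "a \<in> {b1, b2, b3, b4}" for a
  proof -
    have "b1 ** b1 \<in> ?H" "- b2 \<in> ?H" "- b3 \<in> ?H" "- b4 \<in> ?H"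
      by (simp_all add: uminus_in_generate mult_in_generate generate.incl)
    moreover have "b5 ** b2 = - b2 ** b5" "b5 ** b3 = - b3 ** b5" "b5 ** b4 = - b4 ** b5"
      by (simp_all add: matrix_uminus_mult b5_inverts)
    ultimately show ?thesis using that b5_inverts(1) by blast
  qed
  have "card (generate U2 {b1, b2, b3, b4, b5}) * card ?H = card ?H * (card ?H + card ?H)"
    by (rule unitary_extension(2) [of ?H "{b1, b2, b3, b4}" ?H "{b1, b2, b3, b4}" "{}" b5, unfolded eq])
      (use b_in_unitary_group fin b5 in_H conj in \<open>simp_all add: b_squared\<close>)
  then show ?thesis by (simp add: generate_b1_b2_b3_b4(2))
qed

section \<open>Strict inclusions and generation by reflections\<close>

theorem mainTheorem5:
  fixes U :: "(quat ^ 2 ^ 2) monoid" and G2 G3 G4 G5 :: "(quat ^ 2 ^ 2) set"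
  assumes "U = quat_unitary_group"
    and "G2 = generate U {b1, b2}"
    and "G3 = generate U {b1, b2, b3}"
    and "G4 = generate U {b1, b2, b3, b4}"
    and "G5 = generate U {b1, b2, b3, b4, b5}"
  shows "{b1, b2, b3, b4, b5} \<subseteq> carrier U \<and>
         (G2 \<subset> G3 \<and> G3 \<subset> G4 \<and> G4 \<subset> G5) \<and>
         (\<forall>G \<in> {G2, G3, G4, G5}. quat_reflection_group G \<and> quat_irreducible G) \<and>
         card G2 = 24 \<and> card G3 = 120 \<and> card G4 = 720 \<and> card G5 = 1440"
proof -
  note G = assms(2-) [unfolded assms(1)]
  have car: "{b1, b2, b3, b4, b5} \<subseteq> carrier U2" using b_in_unitary_group by simp
  have cards: "card G2 = 24" "card G3 = 120" "card G4 = 720" "card G5 = 1440"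
    by (simp_all add: G generate_b1_b2(2) generate_b1_b2_b3(2) generate_b1_b2_b3_b4(2)
        card_generate_b1_b2_b3_b4_b5)
  have sub: "G2 \<subseteq> G3" "G3 \<subseteq> G4" "G4 \<subseteq> G5"
    unfolding G by (rule U2.mono_generate, fast)+
  have strict: "G2 \<subset> G3" "G3 \<subset> G4" "G4 \<subset> G5"
    using sub cards by (auto simp: psubset_eq)
  have b12: "b1 \<in> G2" "b2 \<in> G2" unfolding G by (simp_all add: generate.incl)
  have irr: "quat_irreducible G2" "quat_irreducible G3" "quat_irreducible G4" "quat_irreducible G5"
    using b12 sub by (auto intro!: quat_irreducibleI)
  \<comment> \<open>It suffices that the generators of each group lie in its subgroup
    \<open>R G\<close>. They enter one at a time: each reflection word contains one new generator,
    and its other factors can be cancelled.\<close>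
  define R where "R G = generate U2 {g \<in> G. quat_reflection g}" for G :: "(quat ^ 2 ^ 2) set"
  have R_mono: "R G \<subseteq> R G'" if "G \<subseteq> G'" for G G'
    unfolding R_def using that by (intro U2.mono_generate) auto
  have R_refl: "g \<in> R G" if "g \<in> G" "quat_reflection g" for g G
    unfolding R_def using that by (simp add: generate.incl)
  have R_mult: "x ** y \<in> R G" if "x \<in> R G" "y \<in> R G" for x y G
    using that mult_in_generate by (simp add: R_def)
  have R_inv: "inv\<^bsub>U2\<^esub> x \<in> R G" if "x \<in> R G" for x G
    using that unfolding R_def by (intro U2.generate_m_inv_closed) (auto simp: quat_reflection_def)
  have cancel: "x \<in> R G" if "x ** y \<in> R G" "y \<in> R G" "x \<in> carrier U2" "y \<in> carrier U2" for x y G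
  proof -
    have "x ** y ** inv\<^bsub>U2\<^esub> y = x"
      using U2.inv_solve_right [of x "x ** y" y] that U2.m_closed [of x y] by simp
    then show ?thesis using R_mult [OF that(1) R_inv [OF that(2)]] by simp
  qed
  have cancel': "y \<in> R G" if "x ** y \<in> R G" "x \<in> R G" "x \<in> carrier U2" "y \<in> carrier U2" for x y G
  proof -
    have "inv\<^bsub>U2\<^esub> x ** (x ** y) = y"
      using U2.inv_solve_left [of y x "x ** y"] that U2.m_closed [of x y] by simp
    then show ?thesis using R_mult [OF R_inv [OF that(2)] that(1)] by simp
  qed
  have mem: "b3 \<in> G3" "b2 \<in> G3" "b3 \<in> G4" "b4 \<in> G4" "b5 \<in> G5" "b2 \<in> G5" "b4 \<in> G5"
    unfolding G by (simp_all add: generate.incl)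
  have words: "b2 ** b1 \<in> G2" "b2 ** b3 \<in> G3" "b3 ** b4 \<in> G4" "b5 ** (b2 ** b4) \<in> G5"
    using b12 mem unfolding G by (simp_all add: mult_in_generate)
  have R2: "b1 \<in> R G2" "b2 \<in> R G2"
    using b12 words quat_reflection_words R_refl b_in_unitary_group cancel by blast+
  then have R3: "b1 \<in> R G3" "b2 \<in> R G3" "b3 \<in> R G3"
    using R_mono [OF sub(1)] words quat_reflection_words R_refl b_in_unitary_group cancel' by blast+
  then have R4: "b1 \<in> R G4" "b2 \<in> R G4" "b3 \<in> R G4" "b4 \<in> R G4"
    using R_mono [OF sub(2)] words quat_reflection_words R_refl b_in_unitary_group cancel' by blast+
  then have R5: "b1 \<in> R G5" "b2 \<in> R G5" "b3 \<in> R G5" "b4 \<in> R G5"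
    using R_mono [OF sub(3)] by auto
  \<comment> \<open>Here the factor to be cancelled is the product \<open>b2 ** b4\<close>, already
    in \<open>R G5\<close>.\<close>
  have "b5 \<in> R G5"
    using cancel [of b5 "b2 ** b4" G5] R_refl [OF words(4) quat_reflection_words(5)]
      R_mult [OF R5(2,4)] b_in_unitary_group U2.m_closed [of b2 b4] by simp
  with R5 have R5: "{b1, b2, b3, b4, b5} \<subseteq> R G5" by simp
  have "quat_reflection_group G2" "quat_reflection_group G3" "quat_reflection_group G4"
    "quat_reflection_group G5"
    using R2 R3 R4 R5 car unfolding R_def
    by (auto intro!: quat_reflection_groupI [OF G(1)] quat_reflection_groupI [OF G(2)]
        quat_reflection_groupI [OF G(3)] quat_reflection_groupI [OF G(4)])
  then show ?thesis using car strict cards irr by (simp add: assms(1))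
qed

end
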